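(* Let $X$ be a Banach space, let $E \subset X$ be an arbitrary subset, let $f: E \to \mathbb{R}$ be a function and let $G: E \rightrightarrows X^*$ be a set-valued mapping such that $G(x)$ is a nonempty convex $w^*$-compact subset of $X^{*}$ for every $x\in E$. There exists a continuous convex function $F: X \to \mathbb{R}$ such that $F(x)=f(x)$ and $\partial F(x)= G(x)$ for every $x\in E$ if and only if the following three conditions are all satisfied. $(C)$: $f(x) \geq f(y)+ y^* (x-y)$ for every $x,y\in E$ and every $y^*\in G(y)$. $(GEX)$: If $(y_k)_k \subset E$ and $(y_k^* )_k \subset X^*$ are sequences such that $y_k^* \in G(y_k)$ for every $k$ and $\lim_k \|y_k^*\|_* =+\infty$, then $$\lim_k \left( y_k^*(y_k-x)-f(y_k) \right)= +\infty \quad \text{for every } x\in X.$$ $(CS)$: If $x\in E$ and $(y_k)_k \subset E$, $(y_k^* )_k \subset X^*$ are sequences such that $y_k^* \in G(y_k)$ for every $k$ and $(y_k^* )_k$ is bounded, then $$\lim_k \left( f(x)-f(y_k)-y_k^* (x-y_k ) \right)=0 \implies G(x) \cap \overline{\lbrace y_k^* \rbrace_k}^{w^*} \neq \emptyset.$$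
   Context: Banach spaces are real. $(X,\|\cdot\|)$ is a Banach space, $X^*$ its topological dual with dual norm $\|\cdot\|_*$, $w^*$ denotes the weak-star topology on $X^*$, and $\overline{\{y_k^*\}_k}^{w^*}$ is the $w^*$-closure of the set $\{y_k^* : k\in\mathbb{N}\}$. A set-valued mapping $G: E \rightrightarrows X^*$ assigns to each $x\in E$ a subset $G(x)\subset X^*$. For a convex function $F:X\to\mathbb{R}$, the subdifferential at $x$ is $\partial F(x)=\{\xi\in X^* : F(z)\ge F(x)+ \xi(z-x) \text{ for all } z\in X\}$. *)

theory Defs
  imports "HOL-Analysis.Analysis"
begin

text \<open>
  The dual of a real normed space \<open>'a\<close> is \<open>'a \<Rightarrow>\<^sub>L real\<close>, whose norm is the operator (dual) norm.
  For scalar-valued operators the strong operator topology, i.e. the topology of pointwise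
  convergence, is the weak-star topology.
\<close>

abbreviation weak_star_topology :: "('a::real_normed_vector \<Rightarrow>\<^sub>L real) topology" where
  "weak_star_topology \<equiv> strong_operator_topology"

definition subdifferential ::
    "('a::real_normed_vector \<Rightarrow> real) \<Rightarrow> 'a \<Rightarrow> ('a \<Rightarrow>\<^sub>L real) set" where
  "subdifferential F x = {\<xi>. \<forall>z. F z \<ge> F x + blinfun_apply \<xi> (z - x)}"

text \<open>
  A function \<open>f : E \<rightarrow> \<real>\<close> and a set-valued mapping \<open>G\<close> on \<open>E\<close> are given by total functions,
  of which only the values on \<open>E\<close> enter.
\<close>

definition cond_C ::
    "'a::real_normed_vector set \<Rightarrow> ('a \<Rightarrow> real) \<Rightarrow> ('a \<Rightarrow> ('a \<Rightarrow>\<^sub>L real) set) \<Rightarrow> bool" where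
  "cond_C E f G \<longleftrightarrow>
     (\<forall>x\<in>E. \<forall>y\<in>E. \<forall>ys\<in>G y. f x \<ge> f y + blinfun_apply ys (x - y))"

definition cond_GEX ::
    "'a::real_normed_vector set \<Rightarrow> ('a \<Rightarrow> real) \<Rightarrow> ('a \<Rightarrow> ('a \<Rightarrow>\<^sub>L real) set) \<Rightarrow> bool" where
  "cond_GEX E f G \<longleftrightarrow>
     (\<forall>(y :: nat \<Rightarrow> 'a) (ys :: nat \<Rightarrow> 'a \<Rightarrow>\<^sub>L real).
        (\<forall>k. y k \<in> E \<and> ys k \<in> G (y k)) \<and> filterlim (\<lambda>k. norm (ys k)) at_top sequentially \<longrightarrow>
        (\<forall>x. filterlim (\<lambda>k. blinfun_apply (ys k) (y k - x) - f (y k)) at_top sequentially))"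

definition cond_CS ::
    "'a::real_normed_vector set \<Rightarrow> ('a \<Rightarrow> real) \<Rightarrow> ('a \<Rightarrow> ('a \<Rightarrow>\<^sub>L real) set) \<Rightarrow> bool" where
  "cond_CS E f G \<longleftrightarrow>
     (\<forall>x\<in>E. \<forall>(y :: nat \<Rightarrow> 'a) (ys :: nat \<Rightarrow> 'a \<Rightarrow>\<^sub>L real).
        (\<forall>k. y k \<in> E \<and> ys k \<in> G (y k)) \<and> bounded (range ys) \<longrightarrow>
        ((\<lambda>k. f x - f (y k) - blinfun_apply (ys k) (x - y k)) \<longlonglongrightarrow> 0) \<longrightarrow>
        G x \<inter> (weak_star_topology closure_of range ys) \<noteq> {})"

end

theory Submission
  imports Defs
begin

text \<open>The candidate is the supremum \<open>F\<close> of the affine functions x |-> f y + g (x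
  - y) with y in \<open>E\<close> and g in \<open>G y\<close>. Condition (C) makes \<open>F\<close>
  agree with \<open>f\<close> on \<open>E\<close> and puts \<open>G x\<close> inside the
  subdifferential. Condition (GEX) keeps the supremum finite at every point
  (\<open>cond_GEX_bdd_above\<close>); by Baire's theorem a finite supremum of continuous convex
  functions is locally bounded above (\<open>SUP_convex_locally_bounded\<close>), hence continuous.
  Condition (CS) stops the subdifferential from exceeding \<open>G x\<close>: a subgradient outside
  this weak-star compact convex set is separated from it by some direction v in X
  (\<open>weak_star_separation\<close>), and the slopes of affine functions that are nearly maximal
  at x + t v stay on the side of the subgradient.

  Conversely, if \<open>F\<close> is given, (C) is the subgradient inequality. A local upper bound
  on \<open>F\<close> bounds the slope of an affine minorant by its value at the centre
  (\<open>norm_le_of_affine_minorant\<close>), so large slopes force very negative values, which is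
  (GEX). For (CS), a weak-star cluster point of the slopes
  (\<open>bounded_sequence_weak_star_cluster\<close>) is a subgradient at x, because the gap at x
  vanishes in the limit.\<close>

section \<open>Convex functions: local bounds, continuity, slopes of minorants\<close>

text \<open>Reflection in the centre turns an upper bound on a ball into a two-sided one, and a
  convex function bounded on an open ball is continuous there.\<close>

lemma continuous_on_convex_locally_bounded:
  fixes F :: "'a::real_normed_vector \<Rightarrow> real"
  assumes F: "convex_on UNIV F" and bd: "\<And>x. \<exists>r>0. \<exists>M. \<forall>z\<in>cball x r. F z \<le> M"
  shows "continuous_on UNIV F"
proof -
  have "isCont F x" for x
  proof -
    obtain r M where r: "r > 0" and M: "\<And>z. z \<in> cball x r \<Longrightarrow> F z \<le> M"
      using bd by blast
    have "convex_on (cball x r) F"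
      using F convex_on_subset by blast
    then have "\<forall>z\<in>ball x r. \<bar>F z\<bar> \<le> M + 2 * \<bar>F x\<bar>"
      using convex_bounds_lemma[of x r F M] M by fastforce
    moreover have "convex_on (ball x r) F"
      using F convex_on_subset by blast
    ultimately have "continuous_on (ball x r) F"
      using convex_on_bounded_continuous[OF open_ball] by blast
    then show ?thesis
      using r by (simp add: continuous_on_eq_continuous_at)
  qed
  then show ?thesis
    by (simp add: continuous_at_imp_continuous_on)
qed

text \<open>The closed sublevel sets at integer heights cover the complete space, so by Baire one of
  them contains a ball. Convexity carries the bound from that ball to a neighbourhood of any other
  point.\<close>

lemma SUP_convex_locally_bounded:
  fixes A :: "'i \<Rightarrow> 'a::banach \<Rightarrow> real"
  assumes ne: "P \<noteq> {}" and cont: "\<And>p. p \<in> P \<Longrightarrow> continuous_on UNIV (A p)"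
    and conv: "\<And>p. p \<in> P \<Longrightarrow> convex_on UNIV (A p)"
    and bdd: "\<And>x. bdd_above ((\<lambda>p. A p x) ` P)"
  shows "convex_on UNIV (\<lambda>x. SUP p\<in>P. A p x)" (is ?thesis1)
    and "\<exists>r>0. \<exists>M. \<forall>z\<in>cball x r. (SUP p\<in>P. A p z) \<le> M" (is ?thesis2)
proof -
  define F where "F x = (SUP p\<in>P. A p x)" for x
  have upper: "A p x \<le> F x" if "p \<in> P" for p x
    unfolding F_def using that bdd by (rule cSUP_upper)
  have least: "F x \<le> b" if "\<And>p. p \<in> P \<Longrightarrow> A p x \<le> b" for x b
    unfolding F_def using ne that by (rule cSUP_least)
  have convF: "convex_on UNIV F"
  proof (rule convex_onI)
    fix t :: real and x y :: 'a
    assume t: "0 < t" "t < 1"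
    show "F ((1 - t) *\<^sub>R x + t *\<^sub>R y) \<le> (1 - t) * F x + t * F y"
    proof (rule least)
      fix p assume p: "p \<in> P"
      have "A p ((1 - t) *\<^sub>R x + t *\<^sub>R y) \<le> (1 - t) * A p x + t * A p y"
        using conv[OF p] t by (intro convex_onD) auto
      also have "\<dots> \<le> (1 - t) * F x + t * F y"
        using t upper[OF p] by (intro add_mono mult_left_mono) auto
      finally show "A p ((1 - t) *\<^sub>R x + t *\<^sub>R y) \<le> (1 - t) * F x + t * F y" .
    qed
  qed simp
  then show ?thesis1
    by (simp add: F_def[abs_def])
  define L where "L n = {x. F x \<le> real n}" for n :: nat
  have L_eq: "L n = (\<Inter>p\<in>P. {x. A p x \<le> real n})" for n
    unfolding L_def using upper least by (auto intro: order_trans)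
  have closed_L: "closed (L n)" for n
    unfolding L_eq using cont by (intro closed_INT ballI closed_Collect_le) auto
  have "\<exists>n. interior (L n) \<noteq> {}"
  proof (rule ccontr)
    assume "\<not> ?thesis"
    then have "euclidean interior_of \<Union>(range L) = {}"
      using closed_L
      by (intro Baire_category_alt) (auto simp: completely_metrizable_space_euclidean)
    moreover have "\<Union>(range L) = UNIV"
      using real_arch_simple by (auto simp: L_def)
    ultimately show False by simp
  qed
  then obtain n c s where s: "s > 0" "ball c s \<subseteq> L n"
    by (metis ex_in_conv mem_interior)
  \<comment> \<open>The reflection of \<open>c\<close> in \<open>x\<close>. Each \<open>z\<close>
    near \<open>x\<close> is the midpoint of \<open>y\<close> and a point \<open>u\<close> with
    \<open>dist c u = 2 * dist x z\<close>, so radius \<open>s / 4\<close> keeps \<open>u\<close>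
    inside the good ball.\<close>
  define y where "y = 2 *\<^sub>R x - c"
  have "F z \<le> (real n + F y) / 2" if z: "z \<in> cball x (s / 4)" for z
  proof -
    define u where "u = 2 *\<^sub>R z - y"
    have "u - c = 2 *\<^sub>R (z - x)"
      by (simp add: u_def y_def algebra_simps scaleR_2)
    then have "dist c u = 2 * dist x z"
      by (metis dist_commute dist_norm abs_numeral norm_scaleR)
    then have "u \<in> L n"
      using z s by auto
    then have "F u \<le> real n"
      by (simp add: L_def)
    moreover have "z = (1 - 1/2) *\<^sub>R u + (1/2) *\<^sub>R y"
      by (simp add: u_def algebra_simps)
    then have "F z \<le> (1 - 1/2) * F u + (1/2) * F y"
      using convex_onD[OF convF, of "1/2" u y] by simp
    ultimately show ?thesis by simp
  qed
  then show ?thesis2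
    using s(1) unfolding F_def
    by (intro exI[of _ "s / 4"] conjI exI[of _ "(real n + F y) / 2"] ballI) (auto simp: F_def)
qed

text \<open>Along any direction scaled to length \<open>r\<close> the minorant rises by at most
  \<open>M - a\<close>; taking both signs gives the bound on the operator norm.\<close>

lemma norm_le_of_affine_minorant:
  fixes \<xi> :: "'a::real_normed_vector \<Rightarrow>\<^sub>L real"
  assumes r: "r > 0" and M: "\<And>z. z \<in> cball x r \<Longrightarrow> F z \<le> M"
    and minorant: "\<And>z. a + blinfun_apply \<xi> (z - x) \<le> F z"
  shows "r * norm \<xi> \<le> M - a"
proof -
  have b: "blinfun_apply \<xi> w \<le> M - a" if "norm w \<le> r" for w
    using minorant[of "x + w"] M[of "x + w"] that by (force simp: dist_norm)
  have "norm \<xi> \<le> (M - a) / r"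
  proof (rule norm_blinfun_bound)
    show "0 \<le> (M - a) / r"
      using b[of 0] r by simp
    fix w
    show "norm (blinfun_apply \<xi> w) \<le> (M - a) / r * norm w"
    proof (cases "w = 0")
      case False
      define k where "k = r / norm w"
      have k: "k > 0" "norm (k *\<^sub>R w) \<le> r" "norm (- (k *\<^sub>R w)) \<le> r"
        using False r by (auto simp: k_def)
      have "k * \<bar>blinfun_apply \<xi> w\<bar> \<le> M - a"
        using b[OF k(2)] b[OF k(3)] k(1)
        by (simp add: blinfun.scaleR_right blinfun.minus_right abs_if)
      then show ?thesis
        using False r by (simp add: k_def field_simps)
    qed simp
  qed
  then show ?thesis
    using r by (simp add: field_simps)
qed

section \<open>Weak-star compactness and separation in the dual\<close>

text \<open>
  Banach--Alaoglu for a sequence: as \<open>X\<close> need not be separable, only a cluster point is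
  obtained, by Tychonoff's theorem in the space of all functions.
\<close>

lemma bounded_sequence_weak_star_cluster:
  fixes \<phi> :: "nat \<Rightarrow> 'a::real_normed_vector \<Rightarrow>\<^sub>L real"
  assumes "bounded (range \<phi>)"
  obtains \<xi> where
    "\<And>U. openin weak_star_topology U \<Longrightarrow> \<xi> \<in> U \<Longrightarrow> \<exists>\<^sub>F k in sequentially. \<phi> k \<in> U"
proof -
  obtain B where B: "\<And>k. norm (\<phi> k) \<le> B"
    using assms by (auto simp: bounded_iff)
  define K where "K = (\<Pi>\<^sub>E z\<in>(UNIV :: 'a set). {- (B * norm z)..B * norm z})"
  define \<F> where "\<F> = filtermap (\<lambda>k. blinfun_apply (\<phi> k)) sequentially"
  have bound: "\<bar>blinfun_apply (\<phi> k) z\<bar> \<le> B * norm z" for k z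
    by (metis B mult_right_mono norm_blinfun norm_ge_zero order_trans real_norm_def)
  have "compact K"
    unfolding compactin_euclidean_iff[symmetric] euclidean_product_topology[symmetric] K_def
    by (simp add: compactin_PiE)
  moreover have "\<F> \<noteq> bot"
    by (simp add: \<F>_def filtermap_bot_iff)
  moreover have "eventually (\<lambda>h. h \<in> K) \<F>"
    using bound by (auto simp: \<F>_def K_def eventually_filtermap abs_le_iff minus_le_iff
        intro!: always_eventually)
  ultimately obtain g where cluster: "inf (nhds g) \<F> \<noteq> bot"
    unfolding compact_filter by blast
  have freq: "\<exists>\<^sub>F k in sequentially. blinfun_apply (\<phi> k) \<in> U" if "open U" "g \<in> U" for U
  proof (rule ccontr)
    assume "\<not> ?thesis"
    then have "eventually (\<lambda>h. h \<notin> U) \<F>"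
      by (simp add: \<F>_def eventually_filtermap not_frequently)
    moreover have "eventually (\<lambda>h. h \<in> U) (nhds g)"
      using that by (rule eventually_nhds_in_open)
    ultimately have "eventually (\<lambda>h. False) (inf (nhds g) \<F>)"
      unfolding eventually_inf by blast
    then show False
      using cluster by (simp add: trivial_limit_def)
  qed
  \<comment> \<open>Closed conditions that hold along the sequence pass to the cluster point; this
    makes \<open>g\<close> linear and bounded.\<close>
  have closedD: "g \<in> C" if "closed C" "\<And>k. blinfun_apply (\<phi> k) \<in> C" for C
    using freq[of "- C"] that by (auto simp: frequently_def)
  have "g (z + w) = g z + g w" for z w
    using closedD[of "{h. h (z + w) = h z + h w}"]
    by (simp add: closed_Collect_eq continuous_intros blinfun.add_right)
  moreover have "g (c *\<^sub>R z) = c *\<^sub>R g z" for c z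
    using closedD[of "{h. h (c *\<^sub>R z) = c * h z}"]
    by (simp add: closed_Collect_eq continuous_intros blinfun.scaleR_right)
  moreover have "norm (g z) \<le> norm z * B" for z
    using closedD[of "{h. \<bar>h z\<bar> \<le> B * norm z}"] bound
    by (simp add: closed_Collect_le continuous_intros mult.commute)
  ultimately have "bounded_linear g"
    by (intro bounded_linear_intro)
  then obtain \<xi> where \<xi>: "blinfun_apply \<xi> = g"
    using bounded_linear_Blinfun_apply by blast
  show thesis
  proof
    fix U
    assume "openin weak_star_topology U" "\<xi> \<in> U"
    then obtain V where "open V" "U = blinfun_apply -` V"
      by (auto simp: strong_operator_topology_def openin_pullback_topology)
    then show "\<exists>\<^sub>F k in sequentially. \<phi> k \<in> U"
      using freq[of V] \<open>\<xi> \<in> U\<close> \<xi> by simp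
  qed
qed

text \<open>
  If no \<open>v\<close> separates, then for finitely many directions \<open>v \<in> V\<close> a minimiser over \<open>S\<close> of the sum
  of the squares \<open>(\<xi> v - g v)\<^sup>2\<close> must attain the value \<open>0\<close>; compactness extends this to all
  directions at once.
\<close>

lemma weak_star_separation:
  fixes \<xi> :: "'a::real_normed_vector \<Rightarrow>\<^sub>L real"
  assumes comp: "compactin weak_star_topology S" and conv: "convex S" and ne: "S \<noteq> {}"
    and "\<xi> \<notin> S"
  obtains v c where "\<And>g. g \<in> S \<Longrightarrow> blinfun_apply g v \<le> c" "c < blinfun_apply \<xi> v"
proof (rule ccontr)
  assume "\<not> thesis"
  with that have nosep: "\<not> (\<forall>g\<in>S. blinfun_apply g v \<le> c)" if "c < blinfun_apply \<xi> v" for v c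
    using that by blast
  define K where "K = blinfun_apply ` S"
  have "continuous_map weak_star_topology euclidean (blinfun_apply :: ('a \<Rightarrow>\<^sub>L real) \<Rightarrow> _)"
    unfolding strong_operator_topology_def
    using continuous_map_pullback[OF continuous_map_id] by simp
  then have K: "compact K"
    unfolding K_def by (metis comp image_compactin compactin_euclidean_iff)
  \<comment> \<open>A point of \<open>K\<close> lying in every \<open>C v\<close> is an element of
    \<open>S\<close> equal to \<open>\<xi>\<close>, so the finite intersection property will
    contradict \<open>\<xi> \<notin> S\<close>.\<close>
  define C where "C v = {h :: 'a \<Rightarrow> real. h v = blinfun_apply \<xi> v}" for v
  have "K \<inter> \<Inter>(range C) \<noteq> {}"
  proof (rule compact_imp_fip[OF K])
    fix T assume "T \<in> range C"
    then show "closed T"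
      by (auto simp: C_def intro!: closed_Collect_eq continuous_intros)
  next
    fix \<T> assume "finite \<T>" "\<T> \<subseteq> range C"
    then obtain V where V: "finite V" "\<T> = C ` V"
      by (meson finite_subset_image)
    define q where "q h = (\<Sum>v\<in>V. (blinfun_apply \<xi> v - h v)\<^sup>2)" for h
    have "K \<noteq> {}"
      using ne by (simp add: K_def)
    have "continuous_on K q"
      unfolding q_def
      by (rule continuous_on_subset[OF _ subset_UNIV]) (intro continuous_intros; simp)
    then obtain h0 where "h0 \<in> K" and min: "\<And>h. h \<in> K \<Longrightarrow> q h0 \<le> q h"
      using continuous_attains_inf[OF K \<open>K \<noteq> {}\<close>] by blast
    then obtain g0 where g0: "g0 \<in> S" "h0 = blinfun_apply g0"
      by (auto simp: K_def)
    define d where "d v = blinfun_apply \<xi> v - blinfun_apply g0 v" for v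
    \<comment> \<open>The derivative of \<open>q\<close> at \<open>h0\<close> towards
      \<open>g\<close> is -2 times \<open>g w - g0 w\<close>, so minimality of \<open>h0\<close>
      says that \<open>g0\<close> maximises evaluation at \<open>w\<close> over
      \<open>S\<close>.\<close>
    define w where "w = (\<Sum>v\<in>V. d v *\<^sub>R v)"
    have app_w: "blinfun_apply g w = (\<Sum>v\<in>V. d v * blinfun_apply g v)" for g :: "'a \<Rightarrow>\<^sub>L real"
      by (simp add: w_def blinfun.sum_right blinfun.scaleR_right)
    have "blinfun_apply g w \<le> blinfun_apply g0 w" if g: "g \<in> S" for g
    proof (rule ccontr)
      define e where "e v = blinfun_apply g v - blinfun_apply g0 v" for v
      define a b where "a = (\<Sum>v\<in>V. d v * e v)" and "b = (\<Sum>v\<in>V. (e v)\<^sup>2)"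
      assume "\<not> ?thesis"
      then have a: "a > 0"
        by (simp add: a_def e_def app_w right_diff_distrib sum_subtractf)
      have b: "b \<ge> 0"
        by (simp add: b_def sum_nonneg)
      \<comment> \<open>Moving by \<open>t\<close> towards \<open>g\<close> changes \<open>q\<close>
        by \<open>t * (t * b - 2 * a)\<close>. This choice makes the change negative while
        \<open>t \<le> 1\<close> keeps the point in \<open>S\<close>.\<close>
      define t where "t = a / (a + b)"
      have t: "0 < t" "t \<le> 1" "t * b < 2 * a"
        using a b by (auto simp: t_def field_simps intro!: add_nonneg_pos)
      have "(1 - t) *\<^sub>R g0 + t *\<^sub>R g \<in> S"
        using conv g g0 t by (simp add: convex_alt)
      then have "q h0 \<le> q (blinfun_apply ((1 - t) *\<^sub>R g0 + t *\<^sub>R g))"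
        using min by (simp add: K_def)
      also have "\<dots> = (\<Sum>v\<in>V. (d v - t * e v)\<^sup>2)"
        unfolding q_def d_def e_def
        by (intro sum.cong) (auto simp: blinfun.add_left blinfun.diff_left blinfun.scaleR_left algebra_simps)
      also have "\<dots> = (\<Sum>v\<in>V. (d v)\<^sup>2 - 2 * t * (d v * e v) + t\<^sup>2 * (e v)\<^sup>2)"
        by (intro sum.cong) (auto simp: power2_eq_square algebra_simps)
      also have "\<dots> = q h0 - 2 * t * a + t\<^sup>2 * b"
        by (simp add: sum.distrib sum_subtractf sum_distrib_left a_def b_def q_def d_def g0)
      finally have "t * (2 * a) \<le> t * (t * b)"
        by (simp add: power2_eq_square mult.assoc mult.left_commute)
      then show False
        using t by simp
    qed
    \<comment> \<open>Otherwise \<open>w\<close> would separate, with the level \<open>c\<close>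
      equal to \<open>g0 w\<close>. Yet \<open>\<xi> w - g0 w\<close> is the minimum of
      \<open>q\<close>, which must therefore be zero.\<close>
    then have "\<not> blinfun_apply g0 w < blinfun_apply \<xi> w"
      using nosep by blast
    moreover have "blinfun_apply \<xi> w - blinfun_apply g0 w = (\<Sum>v\<in>V. (d v)\<^sup>2)"
      by (simp add: app_w d_def power2_eq_square right_diff_distrib flip: sum_subtractf)
    ultimately have "(\<Sum>v\<in>V. (d v)\<^sup>2) \<le> 0"
      by simp
    then have "\<forall>v\<in>V. d v = 0"
      using V(1) by (metis (no_types, lifting) sum_nonneg_eq_0_iff order_antisym sum_nonneg
          zero_le_power2 zero_eq_power2)
    then have "h0 \<in> \<Inter>\<T>"
      by (auto simp: V C_def d_def g0)
    then show "K \<inter> \<Inter>\<T> \<noteq> {}"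
      using \<open>h0 \<in> K\<close> by blast
  qed
  then obtain g where "g \<in> S" "\<And>v. blinfun_apply g v = blinfun_apply \<xi> v"
    by (auto simp: K_def C_def)
  then show False
    using \<open>\<xi> \<notin> S\<close> by (metis blinfun_eqI)
qed

section \<open>Necessity of the conditions\<close>

lemma continuous_locally_bounded_above:
  fixes F :: "'a::real_normed_vector \<Rightarrow> real"
  assumes "continuous_on UNIV F"
  obtains r where "r > 0" "\<And>z. z \<in> cball x r \<Longrightarrow> F z \<le> F x + 1"
proof -
  obtain d where d: "d > 0" "\<And>z. dist z x < d \<Longrightarrow> dist (F z) (F x) < 1"
    using assms unfolding continuous_on_iff by (metis UNIV_I zero_less_one)
  show thesis
  proof
    show "d / 2 > 0" using d by simp
    fix z assume "z \<in> cball x (d / 2)"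
    then have "dist z x < d"
      using d(1) by (simp add: dist_commute)
    then show "F z \<le> F x + 1"
      using d(2)[of z] by (simp add: dist_real_def)
  qed
qed

lemma subdifferentialD:
  "\<xi> \<in> subdifferential F x \<Longrightarrow> F x + blinfun_apply \<xi> (z - x) \<le> F z"
  by (simp add: subdifferential_def)

text \<open>A subgradient at \<open>y k\<close> gives an affine minorant of \<open>F\<close>;
  rewritten with centre \<open>x\<close>, its value there is at most
  \<open>F x + 1 - r * norm (\<phi> k)\<close>.\<close>

lemma cond_GEX_subdifferential:
  fixes F :: "'a::real_normed_vector \<Rightarrow> real"
  assumes cont: "continuous_on UNIV F"
    and F: "\<And>x. x \<in> E \<Longrightarrow> F x = f x" and G: "\<And>x. x \<in> E \<Longrightarrow> subdifferential F x = G x"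
  shows "cond_GEX E f G"
  unfolding cond_GEX_def
proof (intro allI impI, elim conjE)
  fix y :: "nat \<Rightarrow> 'a" and \<phi> :: "nat \<Rightarrow> 'a \<Rightarrow>\<^sub>L real" and x
  assume "\<forall>k. y k \<in> E \<and> \<phi> k \<in> G (y k)"
    and lim: "filterlim (\<lambda>k. norm (\<phi> k)) at_top sequentially"
  then have y: "\<phi> k \<in> subdifferential F (y k)" "F (y k) = f (y k)" for k
    using F G by auto
  obtain r where r: "r > 0" "\<And>z. z \<in> cball x r \<Longrightarrow> F z \<le> F x + 1"
    using continuous_locally_bounded_above[OF cont] by blast
  have le: "- (F x + 1) + r * norm (\<phi> k) \<le> blinfun_apply (\<phi> k) (y k - x) - F (y k)" for k
  proof -
    have "F (y k) + blinfun_apply (\<phi> k) (x - y k) + blinfun_apply (\<phi> k) (z - x) \<le> F z" for z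
      using subdifferentialD[OF y(1)[of k], of z] by (simp add: blinfun.diff_right)
    from norm_le_of_affine_minorant[OF r this] show ?thesis
      by (simp add: blinfun.diff_right)
  qed
  have "filterlim (\<lambda>k. - (F x + 1) + r * norm (\<phi> k)) at_top sequentially"
    using r(1)
    by (intro filterlim_tendsto_add_at_top[OF tendsto_const]
        filterlim_tendsto_pos_mult_at_top[OF tendsto_const _ lim])
  then have "filterlim (\<lambda>k. blinfun_apply (\<phi> k) (y k - x) - F (y k)) at_top sequentially"
    by (rule filterlim_at_top_mono) (intro always_eventually allI le)
  then show "filterlim (\<lambda>k. blinfun_apply (\<phi> k) (y k - x) - f (y k)) at_top sequentially"
    by (simp add: y(2))
qed

text \<open>The subgradient inequality at \<open>y k\<close> reads F z >= F x - gap + \<phi> k (z -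
  x), where the gap tends to 0; it survives at a cluster point of the slopes, which also lies in the
  closure of their range.\<close>

lemma cond_CS_subdifferential:
  fixes F :: "'a::real_normed_vector \<Rightarrow> real"
  assumes F: "\<And>x. x \<in> E \<Longrightarrow> F x = f x" and G: "\<And>x. x \<in> E \<Longrightarrow> subdifferential F x = G x"
  shows "cond_CS E f G"
  unfolding cond_CS_def
proof (intro ballI allI impI, elim conjE)
  fix x and y :: "nat \<Rightarrow> 'a" and \<phi> :: "nat \<Rightarrow> 'a \<Rightarrow>\<^sub>L real"
  assume x: "x \<in> E" and *: "\<forall>k. y k \<in> E \<and> \<phi> k \<in> G (y k)" and bd: "bounded (range \<phi>)"
    and lim: "(\<lambda>k. f x - f (y k) - blinfun_apply (\<phi> k) (x - y k)) \<longlonglongrightarrow> 0"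
  have y: "\<phi> k \<in> subdifferential F (y k)" "F (y k) = f (y k)" for k
    using * F G by auto
  obtain \<xi> where \<xi>: "\<And>U. openin weak_star_topology U \<Longrightarrow> \<xi> \<in> U \<Longrightarrow> \<exists>\<^sub>F k in sequentially. \<phi> k \<in> U"
    using bounded_sequence_weak_star_cluster[OF bd] by blast
  have "F x + blinfun_apply \<xi> (z - x) \<le> F z" for z
  proof (rule field_le_epsilon)
    fix e :: real assume e: "e > 0"
    \<comment> \<open>A weak-star open half-space; the index set \<open>{()}\<close> gives it the
      form used by \<open>strong_operator_topology_basis\<close>.\<close>
    define U where
      "U = {g. \<forall>i\<in>{()}. blinfun_apply g (z - x) \<in> {blinfun_apply \<xi> (z - x) - e / 2<..}}"
    have "\<exists>\<^sub>F k in sequentially. \<phi> k \<in> U"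
      unfolding U_def
      by (rule \<xi>, rule strong_operator_topology_basis) (use e in auto)
    moreover have "\<forall>\<^sub>F k in sequentially. f x - f (y k) - blinfun_apply (\<phi> k) (x - y k) < e / 2"
      by (rule order_tendstoD(2)[OF lim]) (use e in simp)
    ultimately obtain k where k: "\<phi> k \<in> U" "f x - f (y k) - blinfun_apply (\<phi> k) (x - y k) < e / 2"
      using frequently_ex[OF frequently_eventually_frequently] by blast
    then show "F x + blinfun_apply \<xi> (z - x) \<le> F z + e"
      using subdifferentialD[OF y(1)[of k], of z] y(2)[of k] F[OF x]
        by (simp add: U_def blinfun.diff_right)
  qed
  then have "\<xi> \<in> subdifferential F x"
    by (simp add: subdifferential_def)
  moreover have "\<xi> \<in> weak_star_topology closure_of range \<phi>"
    unfolding in_closure_of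
  proof (intro conjI allI impI)
    show "\<xi> \<in> topspace weak_star_topology"
      by (simp add: strong_operator_topology_topspace)
    fix U assume "\<xi> \<in> U \<and> openin weak_star_topology U"
    then show "\<exists>g. g \<in> range \<phi> \<and> g \<in> U"
      using frequently_ex[OF \<xi>] by blast
  qed
  ultimately show "G x \<inter> (weak_star_topology closure_of range \<phi>) \<noteq> {}"
    using G[OF x] by blast
qed

section \<open>Sufficiency: the extension as a supremum of affine functions\<close>

text \<open>Affine functions of the family with values above k at \<open>x\<close> are at most
  \<open>f x0\<close> at \<open>x0\<close> by (C), so their slopes blow up. Then (GEX) sends their
  values at \<open>x\<close> to minus infinity, a contradiction.\<close>

lemma cond_GEX_bdd_above:
  fixes E :: "'a::real_normed_vector set"
  assumes C: "cond_C E f G" and GEX: "cond_GEX E f G" and x0: "x0 \<in> E"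
  shows "bdd_above ((\<lambda>p. f (fst p) + blinfun_apply (snd p) (x - fst p)) ` Sigma E G)"
proof (rule ccontr)
  assume "\<not> ?thesis"
  then have "\<exists>p\<in>Sigma E G. real k < f (fst p) + blinfun_apply (snd p) (x - fst p)" for k :: nat
    by (force simp: bdd_above_def not_le)
  then obtain p where p: "\<And>k. p k \<in> Sigma E G"
    "\<And>k. real k < f (fst (p k)) + blinfun_apply (snd (p k)) (x - fst (p k))"
    by metis
  define y \<phi> where "y k = fst (p k)" and "\<phi> k = snd (p k)" for k
  have y: "y k \<in> E \<and> \<phi> k \<in> G (y k)" for k
    using p(1)[of k] by (auto simp: y_def \<phi>_def)
  have big: "real k < f (y k) + blinfun_apply (\<phi> k) (x - y k)" for k
    using p(2) by (simp add: y_def \<phi>_def)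
  have norm_big: "real k - f x0 \<le> norm (\<phi> k) * norm (x - x0)" for k
  proof -
    have "f y' + blinfun_apply g (x0 - y') \<le> f x0" if "y' \<in> E" "g \<in> G y'" for y' g
      using C x0 that by (auto simp: cond_C_def)
    from this[of "y k" "\<phi> k"] y big[of k]
    have "real k - f x0 \<le> blinfun_apply (\<phi> k) (x - x0)"
      by (simp add: blinfun.diff_right)
    also have "\<dots> \<le> norm (\<phi> k) * norm (x - x0)"
      by (metis abs_ge_self norm_blinfun order_trans real_norm_def)
    finally show ?thesis .
  qed
  have "filterlim (\<lambda>k. real k - f x0) at_top sequentially"
    using filterlim_tendsto_add_at_top[OF tendsto_const[of "- f x0"] filterlim_real_sequentially]
    by simp
  then have lim: "filterlim (\<lambda>k. norm (\<phi> k) * norm (x - x0)) at_top sequentially"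
    by (rule filterlim_at_top_mono) (intro always_eventually allI norm_big)
  then have "x \<noteq> x0"
    by (auto simp: filterlim_at_top dest: spec[of _ 1])
  then have "filterlim (\<lambda>k. inverse (norm (x - x0)) * (norm (\<phi> k) * norm (x - x0))) at_top sequentially"
    by (intro filterlim_tendsto_pos_mult_at_top[OF tendsto_const _ lim]) simp
  then have "filterlim (\<lambda>k. norm (\<phi> k)) at_top sequentially"
    using \<open>x \<noteq> x0\<close> by (simp add: field_simps)
  then have "filterlim (\<lambda>k. blinfun_apply (\<phi> k) (y k - x) - f (y k)) at_top sequentially"
    using GEX y unfolding cond_GEX_def by blast
  then have "\<forall>\<^sub>F k in sequentially. 0 \<le> blinfun_apply (\<phi> k) (y k - x) - f (y k)"
    unfolding filterlim_at_top by blast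
  then obtain k where "0 \<le> blinfun_apply (\<phi> k) (y k - x) - f (y k)"
    by (auto simp: eventually_sequentially)
  then show False
    using big[of k] by (simp add: blinfun.diff_right)
qed

text \<open>
  The smallest extension \<open>F x = sup {f y + y\<^sup>* (x - y)}\<close> already has the prescribed
  subdifferentials. If \<open>\<xi> \<in> \<partial>F x\<close> were separated from \<open>G x\<close> by a direction \<open>v\<close>, then affine
  functions nearly attaining \<open>F (x + t v)\<close> with \<open>t \<rightarrow> 0\<close> would have bounded slopes which are
  asymptotically tight at \<open>x\<close> and at least \<open>\<xi> v - t\<close> in direction \<open>v\<close>, against condition (CS).
\<close>

lemma convex_extension_exists:
  fixes E :: "'a::banach set"
  assumes ne: "\<And>x. x \<in> E \<Longrightarrow> G x \<noteq> {}" and conv: "\<And>x. x \<in> E \<Longrightarrow> convex (G x)"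
    and comp: "\<And>x. x \<in> E \<Longrightarrow> compactin weak_star_topology (G x)"
    and C: "cond_C E f G" and GEX: "cond_GEX E f G" and CS: "cond_CS E f G"
  shows "\<exists>F. continuous_on UNIV F \<and> convex_on UNIV F \<and>
           (\<forall>x\<in>E. F x = f x \<and> subdifferential F x = G x)"
proof (cases "E = {}")
  case True
  then show ?thesis
    \<comment> \<open>The family of affine functions is empty here, so the supremum is replaced by
      the zero function.\<close>
    by (intro exI[of _ "\<lambda>_. 0"]) (simp add: convex_on_const)
next
  case False
  then obtain x0 where x0: "x0 \<in> E" by blast
  define P where "P = Sigma E G"
  define A where "A p x = f (fst p) + blinfun_apply (snd p) (x - fst p)" for p and x :: 'a
  define F where "F x = (SUP p\<in>P. A p x)" for x
  have P: "P \<noteq> {}"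
    using x0 ne by (auto simp: P_def)
  have A_cont: "continuous_on UNIV (A p)" for p
    unfolding A_def by (intro continuous_intros)
  have A_conv: "convex_on UNIV (A p)" for p
  proof (rule convex_onI)
    fix t :: real and x y :: 'a
    show "A p ((1 - t) *\<^sub>R x + t *\<^sub>R y) \<le> (1 - t) * A p x + t * A p y"
      by (simp add: A_def blinfun.diff_right blinfun.add_right blinfun.scaleR_right algebra_simps)
  qed simp
  have bdd: "bdd_above ((\<lambda>p. A p x) ` P)" for x
    using cond_GEX_bdd_above[OF C GEX x0] by (simp add: A_def P_def)
  have upper: "A p x \<le> F x" if "p \<in> P" for p x
    unfolding F_def using that bdd by (rule cSUP_upper)
  have F_conv: "convex_on UNIV F"
    and F_bd: "\<And>x. \<exists>r>0. \<exists>M. \<forall>z\<in>cball x r. F z \<le> M"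
    using SUP_convex_locally_bounded[where P = P and A = A, OF P A_cont A_conv bdd]
    by (simp_all add: F_def[abs_def])
  have F_cont: "continuous_on UNIV F"
    using F_conv F_bd by (rule continuous_on_convex_locally_bounded)
  have near: "\<exists>y g. y \<in> E \<and> g \<in> G y \<and> F x - e < f y + blinfun_apply g (x - y)" if "e > 0" for x e
  proof -
    have "F x - e < (SUP p\<in>P. A p x)"
      using that by (simp add: F_def)
    then show ?thesis
      using less_cSUP_iff[OF P bdd] by (auto simp: P_def A_def)
  qed
  have minorant: "f y + blinfun_apply g (z - y) \<le> F z" if "y \<in> E" "g \<in> G y" for y g z
    using upper[of "(y, g)" z] that by (simp add: P_def A_def)
  have Ff: "F x = f x" if x: "x \<in> E" for x
  proof (rule antisym)
    show "F x \<le> f x"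
      unfolding F_def
      using P C x by (intro cSUP_least) (auto simp: P_def A_def cond_C_def)
    show "f x \<le> F x"
      using minorant[OF x, of _ x] ne[OF x] by auto
  qed
  have sub: "\<xi> \<in> G x" if x: "x \<in> E" and \<xi>: "\<xi> \<in> subdifferential F x" for x \<xi>
  proof (rule ccontr)
    assume "\<xi> \<notin> G x"
    then obtain v c where v: "\<And>g. g \<in> G x \<Longrightarrow> blinfun_apply g v \<le> c" "c < blinfun_apply \<xi> v"
      using weak_star_separation[OF comp conv ne] x by metis
    \<comment> \<open>Half the separation gap leaves strict room above \<open>c\<close>; the cap 1
      keeps every \<open>t k\<close> at most 1 for the norm bound on the slopes.\<close>
    define \<delta> where "\<delta> = min 1 ((blinfun_apply \<xi> v - c) / 2)"
    have \<delta>: "0 < \<delta>" "c < blinfun_apply \<xi> v - \<delta>"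
      using v(2) by (auto simp: \<delta>_def min_def field_simps)
    \<comment> \<open>The bound holds on radius \<open>2 * r\<close> so that balls of radius
      \<open>r\<close> around the points \<open>x + t k *\<^sub>R v\<close> are covered;
      \<open>\<eta>\<close> limits the displacement to \<open>r\<close>.\<close>
    obtain r M where r: "r > 0" and M: "\<And>z. z \<in> cball x (2 * r) \<Longrightarrow> F z \<le> M"
    proof -
      obtain s M where "s > 0" "\<forall>z\<in>cball x s. F z \<le> M"
        using F_bd by blast
      then show thesis
        using that[of "s / 2" M] by auto
    qed
    define \<eta> where "\<eta> = min \<delta> (r / (norm v + 1))"
    have "norm v + 1 > 0"
      using norm_ge_zero[of v] by linarith
    then have \<eta>: "0 < \<eta>" "\<eta> \<le> \<delta>" "\<eta> * norm v \<le> r"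
    proof -
      show "0 < \<eta>" "\<eta> \<le> \<delta>"
        using \<delta>(1) r \<open>norm v + 1 > 0\<close> by (auto simp: \<eta>_def)
      have "\<eta> * norm v \<le> r / (norm v + 1) * (norm v + 1)"
        using r \<open>0 < \<eta>\<close> by (intro mult_mono) (auto simp: \<eta>_def)
      then show "\<eta> * norm v \<le> r"
        using \<open>norm v + 1 > 0\<close> by simp
    qed
    define t where "t k = \<eta> * inverse (real (Suc k))" for k
    have t: "0 < t k" "t k \<le> \<eta>" for k
      using \<eta>(1) by (auto simp: t_def field_simps)
    have t_lim: "t \<longlonglongrightarrow> 0"
      using tendsto_mult_right_zero[OF LIMSEQ_inverse_real_of_nat, of \<eta>]
      by (simp add: t_def[abs_def])
    \<comment> \<open>The tolerance is quadratic so that after division by \<open>t k\<close> an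
      error of only \<open>t k\<close> remains in the slope.\<close>
    have "\<exists>y g. y \<in> E \<and> g \<in> G y \<and>
        F (x + t k *\<^sub>R v) - (t k)\<^sup>2 < f y + blinfun_apply g (x + t k *\<^sub>R v - y)" for k
      by (rule near) (use t(1)[of k] in simp)
    then obtain y \<phi> where y: "\<And>k. y k \<in> E \<and> \<phi> k \<in> G (y k)" and
      tight: "\<And>k. F (x + t k *\<^sub>R v) - (t k)\<^sup>2 < f (y k) + blinfun_apply (\<phi> k) (x + t k *\<^sub>R v - y k)"
      by metis
    have tight': "F x + t k * blinfun_apply \<xi> v - (t k)\<^sup>2
        < f (y k) + blinfun_apply (\<phi> k) (x + t k *\<^sub>R v - y k)" for k
      using subdifferentialD[OF \<xi>, of "x + t k *\<^sub>R v"] tight[of k]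
      by (simp add: blinfun.scaleR_right)
    \<comment> \<open>The chosen affine function is at most \<open>F x\<close> at \<open>x\<close>
      and nearly at least \<open>F x + t k * \<xi> v\<close> at \<open>x + t k *\<^sub>R v\<close>,
      which forces its increase along \<open>v\<close>.\<close>
    have slope: "blinfun_apply \<xi> v - \<delta> \<le> blinfun_apply (\<phi> k) v" for k
    proof -
      have "f (y k) + blinfun_apply (\<phi> k) (x - y k) \<le> F x"
        using minorant y by blast
      then have "t k * blinfun_apply \<xi> v < t k * (blinfun_apply (\<phi> k) v + t k)"
        using tight'[of k]
        by (simp add: blinfun.diff_right blinfun.add_right blinfun.scaleR_right algebra_simps
            power2_eq_square)
      then have "blinfun_apply \<xi> v < blinfun_apply (\<phi> k) v + t k"
        using t(1)[of k] by simp
      then show ?thesis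
        using t(2)[of k] \<eta>(2) by linarith
    qed
    have norm_\<phi>: "norm (\<phi> k) \<le> (M - (F x - \<bar>blinfun_apply \<xi> v\<bar> - 1)) / r" for k
    proof -
      have t1: "t k \<le> 1"
        using t(2)[of k] \<eta>(2) by (simp add: \<delta>_def)
      have "t k * \<bar>blinfun_apply \<xi> v\<bar> \<le> 1 * \<bar>blinfun_apply \<xi> v\<bar>"
        using t1 by (intro mult_right_mono) auto
      moreover have "- (t k * \<bar>blinfun_apply \<xi> v\<bar>) \<le> t k * blinfun_apply \<xi> v"
        using t(1)[of k] by (simp add: abs_if)
      moreover have "(t k)\<^sup>2 \<le> 1"
        using t(1)[of k] t1 by (simp add: power_le_one)
      ultimately have a: "F x - \<bar>blinfun_apply \<xi> v\<bar> - 1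
          \<le> f (y k) + blinfun_apply (\<phi> k) (x + t k *\<^sub>R v - y k)"
        using tight'[of k] by linarith
      have "r * norm (\<phi> k) \<le> M - (f (y k) + blinfun_apply (\<phi> k) (x + t k *\<^sub>R v - y k))"
      proof (rule norm_le_of_affine_minorant[where F = F, OF r])
        fix z
        show "f (y k) + blinfun_apply (\<phi> k) (x + t k *\<^sub>R v - y k) +
            blinfun_apply (\<phi> k) (z - (x + t k *\<^sub>R v)) \<le> F z"
          using minorant[of "y k" "\<phi> k" z] y by (simp add: blinfun.diff_right)
        assume z: "z \<in> cball (x + t k *\<^sub>R v) r"
        have "dist x (x + t k *\<^sub>R v) \<le> \<eta> * norm v"
          using t[of k] by (simp add: dist_norm mult_right_mono)
        then have "dist x z \<le> 2 * r"
          using z \<eta>(3) dist_triangle[of x z "x + t k *\<^sub>R v"] by simp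
        then show "F z \<le> M"
          by (intro M) simp
      qed
      then have "r * norm (\<phi> k) \<le> M - (F x - \<bar>blinfun_apply \<xi> v\<bar> - 1)"
        using a by linarith
      then show ?thesis
        using r by (simp add: field_simps)
    qed
    then obtain B where B: "\<And>k. norm (\<phi> k) \<le> B"
      by blast
    have "(\<lambda>k. f x - f (y k) - blinfun_apply (\<phi> k) (x - y k)) \<longlonglongrightarrow> 0"
    proof (rule tendsto_sandwich)
      show "\<forall>\<^sub>F k in sequentially. 0 \<le> f x - f (y k) - blinfun_apply (\<phi> k) (x - y k)"
        using minorant[of "y _" "\<phi> _" x] y Ff[OF x] by (auto intro!: always_eventually simp: algebra_simps)
      show "\<forall>\<^sub>F k in sequentially. f x - f (y k) - blinfun_apply (\<phi> k) (x - y k)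
          \<le> t k * (B * norm v) - t k * blinfun_apply \<xi> v + (t k)\<^sup>2"
      proof (intro always_eventually allI)
        fix k
        have "blinfun_apply (\<phi> k) v \<le> B * norm v"
          by (metis B abs_ge_self mult_right_mono norm_blinfun norm_ge_zero order_trans real_norm_def)
        then have "t k * blinfun_apply (\<phi> k) v \<le> t k * (B * norm v)"
          using t(1)[of k] by simp
        then show "f x - f (y k) - blinfun_apply (\<phi> k) (x - y k)
            \<le> t k * (B * norm v) - t k * blinfun_apply \<xi> v + (t k)\<^sup>2"
          using tight'[of k] Ff[OF x]
          by (simp add: blinfun.diff_right blinfun.add_right blinfun.scaleR_right)
      qed
      have "(\<lambda>k. t k * (B * norm v) - t k * blinfun_apply \<xi> v + (t k)\<^sup>2)
          \<longlonglongrightarrow> 0 * (B * norm v) - 0 * blinfun_apply \<xi> v + 0\<^sup>2"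
        by (intro tendsto_intros t_lim)
      then show "(\<lambda>k. t k * (B * norm v) - t k * blinfun_apply \<xi> v + (t k)\<^sup>2) \<longlonglongrightarrow> 0"
        by simp
    qed simp
    moreover have "bounded (range \<phi>)"
      using B by (auto simp: bounded_iff)
    ultimately have "G x \<inter> (weak_star_topology closure_of range \<phi>) \<noteq> {}"
      using CS x y unfolding cond_CS_def by blast
    then obtain g where g: "g \<in> G x" "g \<in> weak_star_topology closure_of range \<phi>"
      by blast
    \<comment> \<open>This half-space contains \<open>g\<close>, since \<open>g v \<le> c\<close>,
      but by \<open>slope\<close> it contains no \<open>\<phi> k\<close>.\<close>
    define U where "U = {h. \<forall>i\<in>{()}. blinfun_apply h v \<in> {..<blinfun_apply \<xi> v - \<delta>}}"
    have "openin weak_star_topology U"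
      unfolding U_def by (rule strong_operator_topology_basis) auto
    moreover have "g \<in> U"
      using v(1)[OF g(1)] \<delta>(2) by (simp add: U_def)
    ultimately obtain h where "h \<in> range \<phi>" "h \<in> U"
      using g(2) unfolding in_closure_of by blast
    then show False
      using slope by (auto simp: U_def not_less[symmetric])
  qed
  have "subdifferential F x = G x" if x: "x \<in> E" for x
    using sub[OF x] minorant[OF x] Ff[OF x] by (auto simp: subdifferential_def)
  then show ?thesis
    using F_cont F_conv Ff by blast
qed

theorem theorem1p6:
  fixes E :: "'a::banach set"
    and f :: "'a \<Rightarrow> real"
    and G :: "'a \<Rightarrow> ('a \<Rightarrow>\<^sub>L real) set"
  assumes "\<And>x. x \<in> E \<Longrightarrow> G x \<noteq> {}"
    and "\<And>x. x \<in> E \<Longrightarrow> convex (G x)"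
    and "\<And>x. x \<in> E \<Longrightarrow> compactin weak_star_topology (G x)"
  shows "(\<exists>F :: 'a \<Rightarrow> real. continuous_on UNIV F \<and> convex_on UNIV F \<and>
            (\<forall>x\<in>E. F x = f x \<and> subdifferential F x = G x)) \<longleftrightarrow>
         cond_C E f G \<and> cond_GEX E f G \<and> cond_CS E f G"
proof
  assume "\<exists>F :: 'a \<Rightarrow> real. continuous_on UNIV F \<and> convex_on UNIV F \<and>
            (\<forall>x\<in>E. F x = f x \<and> subdifferential F x = G x)"
  then obtain F :: "'a \<Rightarrow> real" where cont: "continuous_on UNIV F"
    and F: "\<And>x. x \<in> E \<Longrightarrow> F x = f x" and G: "\<And>x. x \<in> E \<Longrightarrow> subdifferential F x = G x"
    by blast
  have "cond_C E f G"
    unfolding cond_C_def by (metis F G subdifferentialD)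
  then show "cond_C E f G \<and> cond_GEX E f G \<and> cond_CS E f G"
    using cond_GEX_subdifferential[OF cont F G] cond_CS_subdifferential[OF F G] by blast
next
  assume "cond_C E f G \<and> cond_GEX E f G \<and> cond_CS E f G"
  then show "\<exists>F :: 'a \<Rightarrow> real. continuous_on UNIV F \<and> convex_on UNIV F \<and>
            (\<forall>x\<in>E. F x = f x \<and> subdifferential F x = G x)"
    by (elim conjE) (rule convex_extension_exists[OF assms])
qed

end
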